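(* Let $\beta$ be a bilinear map with representation $[L;R;P]$, let $\ell\ge0$, and let $$f^{(\ell)}_{p,q}=\gamma_{p,q}^{\ell}\left(f^{(0)}_{p,q}+Q_0\,\Gamma^{(0)}_{p,q}\sum_{i=0}^{\ell-1}\left(\frac{\Gamma_{p,q}}{\gamma_{p,q}}\right)^{i}\right)$$ be its recursive forward error factor. For $t<\gamma_{p,q}$ put $Q_t=Q_0\,\dfrac{\gamma_{p,q}}{\gamma_{p,q}-t}$ (which depends on $(p,q)$); it is increasing with respect to $t$. When $\beta$ encodes an $m\times k$ by $k\times n$ matrix multiplication algorithm with $k\ge2$, with $m_0\times k_0$ by $k_0\times n_0$ classical matrix multiplication as base case, with $K=k_0k^\ell$, and with $\Gamma_{p,q}<\gamma_{p,q}$ for the pair $(p,q)$ considered: 1. $f^{(\ell)}_{\infty,\infty}=\gamma_{\infty,\infty}^\ell\,(k_0^2+k_0Q_k)-k_0k^\ell Q_k=\left(\frac{K}{k_0}\right)^{\log_k\gamma_{\infty,\infty}}(k_0^2+k_0Q_k)-KQ_k$; 2. $f^{(\ell)}_{2,2}=\gamma_{2,2}^\ell\,(k_0+Q_1)-Q_1=\left(\frac{K}{k_0}\right)^{\log_k\gamma_{2,2}}(k_0+Q_1)-Q_1$; 3. $f^{(\ell)}_{2,\infty}=\gamma_{2,\infty}^\ell\,k_0^{3/2}(k_0+Q_{k^{3/2}})-Q_{k^{3/2}}(k_0k^\ell)^{3/2}=\left(\frac{K}{k_0}\right)^{\log_k\gamma_{2,\infty}}k_0^{3/2}(k_0+Q_{k^{3/2}})-Q_{k^{3/2}}K^{3/2}$;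 4. $f^{(\ell)}_{\infty,2}=\gamma_{\infty,2}^\ell\,(k_0+Q_1)-Q_1=\left(\frac{K}{k_0}\right)^{\log_k\gamma_{\infty,2}}(k_0+Q_1)-Q_1$. Otherwise, with a general tensor, and with $g\ge2$ and $G=g_0g^\ell$, $$f^{(\ell)}_{p,q}=\gamma_{p,q}^\ell\bigl(f^{(0)}_{p,q}+\ell\,Q_0\,\gamma^{(0)}_{p,q}\bigr)=\left(\frac{G}{g_0}\right)^{\log_g\gamma_{p,q}}\left(f^{(0)}_{p,q}+\log_g\!\left(\frac{G}{g_0}\right)Q_0\,\gamma^{(0)}_{p,q}\right).$$
   Context: **Norms.** $\|\cdot\|_p$, $\|\cdot\|_q$ ($p,q\in[1,\infty]$) are the usual $\ell_p,\ell_q$ norms of real vectors, $\|\cdot\|_{q^\star}$ the dual norm of $\|\cdot\|_q$, $\|x\|_0$ the number of nonzero entries. $A_{i,*}$ and $A_{*,i}$ are the $i$-th row and column of $A$. **Representation.** $[L;R;P]$ with $L\in\mathbb{R}^{r\times e}$, $R\in\mathbb{R}^{r\times f}$, $P\in\mathbb{R}^{g\times r}$ represents $\beta:\mathbb{R}^e\times\mathbb{R}^f\to\mathbb{R}^g$ if $\beta(u,v)=\sum_{i=1}^rP_{*,i}(L_{i,*}\cdot u)(R_{i,*}\cdot v)$. The recursive map $\beta^{\otimes^\ell}:\mathbb{R}^{e_0e^\ell}\times\mathbb{R}^{f_0f^\ell}\to\mathbb{R}^{g_0g^\ell}$ applies $\beta$ blockwise $\ell$ times, with the base case $\beta^{(0)}:\mathbb{R}^{e_0}\times\mathbb{R}^{f_0}\to\mathbb{R}^{g_0}$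 at the leaves. The factor $f^{(\ell)}_{p,q}$ is the constant appearing in the forward error bound $\|\widehat{\beta^{\otimes^\ell}(u,v)}-\beta^{\otimes^\ell}(u,v)\|_p\le f^{(\ell)}_{p,q}\|u\|_q\|v\|_q\varepsilon+O(\varepsilon^2)$ with machine precision $\varepsilon$. **Constants.** - $\gamma_{p,q}=\bigl\|\bigl(\sum_{i=1}^r\|L_{i,*}\|_{q^\star}\|R_{i,*}\|_{q^\star}|p_{j,i}|\bigr)_j\bigr\|_p$ (growth factor), assumed nonzero. - $Q_0=\max_j\bigl(\|P_{j,*}\|_0+\max_i(\|L_{i,*}\|_0+\|R_{i,*}\|_0)\mathbb{1}_{p_{j,i}\neq0}\bigr)$. - Amplification factors: in the matrix multiplication case, $(\Gamma^{(0)}_{\infty,\infty},\Gamma_{\infty,\infty})=(k_0,k)$, $(\Gamma^{(0)}_{2,2},\Gamma_{2,2})=(1,1)$, $(\Gamma^{(0)}_{\infty,2},\Gamma_{\infty,2})=(1,1)$, $(\Gamma^{(0)}_{2,\infty},\Gamma_{2,\infty})=(k_0^{3/2},k^{3/2})$. For a general tensor, $(\Gamma^{(0)}_{p,q},\Gamma_{p,q})=(\gamma^{(0)}_{p,q},\gamma_{p,q})$, where $\gamma^{(0)}_{p,q}$ is such that $\|\beta^{(0)}(u,v)\|_p\le\gamma^{(0)}_{p,q}\|u\|_q\|v\|_q$ for all $u,v$. - Base case error factor $f^{(0)}_{p,q}$: a constant with $\|\widehat{\beta^{(0)}}(u,v)-\beta^{(0)}(u,v)\|_p\le f^{(0)}_{p,q}\|u\|_q\|v\|_q\varepsilon+O(\varepsilon^2)$.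 For the classical matrix multiplication base case the values used are $f^{(0)}_{\infty,\infty}=k_0^2$, $f^{(0)}_{2,2}=k_0$, $f^{(0)}_{\infty,2}=k_0$, $f^{(0)}_{2,\infty}=k_0^{5/2}$. *)

theory Defs
  imports "HOL-Analysis.Analysis" "HOL-Library.Landau_Symbols"
begin

text \<open>Exponents of norms range over the extended reals, restricted to \<open>1 \<le> p \<le> \<infinity>\<close> where used.\<close>

definition lp_norm :: "ereal \<Rightarrow> real ^ 'n \<Rightarrow> real" where
  "lp_norm p x =
     (if p = \<infinity> then Max (range (\<lambda>i. \<bar>x $ i\<bar>))
      else (\<Sum>i\<in>UNIV. \<bar>x $ i\<bar> powr real_of_ereal p) powr (1 / real_of_ereal p))"

definition lp_dual_norm :: "ereal \<Rightarrow> real ^ 'n \<Rightarrow> real" where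
  "lp_dual_norm q x = (SUP y\<in>{y. lp_norm q y \<le> 1}. x \<bullet> y)"

definition l0_norm :: "real ^ 'n \<Rightarrow> nat" where
  "l0_norm x = card {i. x $ i \<noteq> 0}"

definition represents ::
  "real ^ 'e ^ 'r \<Rightarrow> real ^ 'f ^ 'r \<Rightarrow> real ^ 'r ^ 'g \<Rightarrow>
     (real ^ 'e \<Rightarrow> real ^ 'f \<Rightarrow> real ^ 'g) \<Rightarrow> bool" where
  "represents L R P \<beta> \<longleftrightarrow>
     (\<forall>u v. \<beta> u v = (\<Sum>i\<in>UNIV. ((row i L \<bullet> u) * (row i R \<bullet> v)) *\<^sub>R column i P))"

definition growth_factor ::
  "real ^ 'e ^ 'r \<Rightarrow> real ^ 'f ^ 'r \<Rightarrow> real ^ 'r ^ 'g \<Rightarrow> ereal \<Rightarrow> ereal \<Rightarrow> real" where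
  "growth_factor L R P p q =
     lp_norm p (\<chi> j. \<Sum>i\<in>UNIV.
       lp_dual_norm q (row i L) * lp_dual_norm q (row i R) * \<bar>P $ j $ i\<bar>)"

definition Q_zero ::
  "real ^ 'e ^ 'r \<Rightarrow> real ^ 'f ^ 'r \<Rightarrow> real ^ 'r ^ 'g \<Rightarrow> nat" where
  "Q_zero L R P =
     Max (range (\<lambda>j. l0_norm (row j P) +
       Max (range (\<lambda>i. (l0_norm (row i L) + l0_norm (row i R)) * of_bool (P $ j $ i \<noteq> 0)))))"

definition Q_shift ::
  "real ^ 'e ^ 'r \<Rightarrow> real ^ 'f ^ 'r \<Rightarrow> real ^ 'r ^ 'g \<Rightarrow> ereal \<Rightarrow> ereal \<Rightarrow> real \<Rightarrow> real" where
  "Q_shift L R P p q t =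
     real (Q_zero L R P) * (growth_factor L R P p q / (growth_factor L R P p q - t))"

text \<open>The arguments \<open>f0\<close>, \<open>\<Gamma>0\<close> and \<open>\<Gamma>\<close> are the base case error factor, the base case
  amplification factor and the amplification factor, all for the same pair \<open>(p, q)\<close>.\<close>

definition rec_error_factor ::
  "real ^ 'e ^ 'r \<Rightarrow> real ^ 'f ^ 'r \<Rightarrow> real ^ 'r ^ 'g \<Rightarrow> ereal \<Rightarrow> ereal \<Rightarrow>
     real \<Rightarrow> real \<Rightarrow> real \<Rightarrow> nat \<Rightarrow> real" where
  "rec_error_factor L R P p q f0 \<Gamma>0 \<Gamma> l =
     growth_factor L R P p q ^ l *
       (f0 + real (Q_zero L R P) * \<Gamma>0 * (\<Sum>i<l. (\<Gamma> / growth_factor L R P p q) ^ i))"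

text \<open>A bijection \<open>\<sigma>\<close> from pairs of matrix indices to vector indices is a choice of
  vectorization (row-major, column-major, ...).\<close>

definition vectorize :: "('m \<times> 'n \<Rightarrow> 'd) \<Rightarrow> real ^ 'n ^ 'm \<Rightarrow> real ^ 'd" where
  "vectorize \<sigma> A = (\<chi> x. A $ fst (inv \<sigma> x) $ snd (inv \<sigma> x))"

definition encodes_matmul ::
  "('m::finite \<times> 'k::finite \<Rightarrow> 'e::finite) \<Rightarrow> ('k \<times> 'n::finite \<Rightarrow> 'f::finite) \<Rightarrow>
     ('m \<times> 'n \<Rightarrow> 'g::finite) \<Rightarrow> (real ^ 'e \<Rightarrow> real ^ 'f \<Rightarrow> real ^ 'g) \<Rightarrow> bool" where
  "encodes_matmul \<sigma> \<tau> \<rho> \<beta> \<longleftrightarrow>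
     bij \<sigma> \<and> bij \<tau> \<and> bij \<rho> \<and>
     (\<forall>(A :: real ^ 'k ^ 'm) (B :: real ^ 'n ^ 'k).
        \<beta> (vectorize \<sigma> A) (vectorize \<tau> B) = vectorize \<rho> (A ** B))"

text \<open>Amplification factor of a multiplication with inner dimension \<open>k\<close>, and forward error
  factor of the classical multiplication with inner dimension \<open>k\<close>. Both are only given for
  exponents in \<open>{2, \<infinity>}\<close>.\<close>

definition matmul_amplification :: "ereal \<Rightarrow> ereal \<Rightarrow> nat \<Rightarrow> real" where
  "matmul_amplification p q k =
     (if p = \<infinity> \<and> q = \<infinity> then real k
      else if p = 2 \<and> q = 2 then 1
      else if p = \<infinity> \<and> q = 2 then 1
      else if p = 2 \<and> q = \<infinity> then real k powr (3/2)
      else undefined)"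

definition classical_error_factor :: "ereal \<Rightarrow> ereal \<Rightarrow> nat \<Rightarrow> real" where
  "classical_error_factor p q k =
     (if p = \<infinity> \<and> q = \<infinity> then real k ^ 2
      else if p = 2 \<and> q = 2 then real k
      else if p = \<infinity> \<and> q = 2 then real k
      else if p = 2 \<and> q = \<infinity> then real k powr (5/2)
      else undefined)"

definition rec_error_factor_matmul ::
  "real ^ 'e ^ 'r \<Rightarrow> real ^ 'f ^ 'r \<Rightarrow> real ^ 'r ^ 'g \<Rightarrow> nat \<Rightarrow> nat \<Rightarrow> ereal \<Rightarrow> ereal \<Rightarrow>
     nat \<Rightarrow> real" where
  "rec_error_factor_matmul L R P k0 k p q l =
     rec_error_factor L R P p q (classical_error_factor p q k0)
       (matmul_amplification p q k0) (matmul_amplification p q k) l"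

definition rec_error_factor_tensor ::
  "real ^ 'e ^ 'r \<Rightarrow> real ^ 'f ^ 'r \<Rightarrow> real ^ 'r ^ 'g \<Rightarrow> real \<Rightarrow> real \<Rightarrow> ereal \<Rightarrow> ereal \<Rightarrow>
     nat \<Rightarrow> real" where
  "rec_error_factor_tensor L R P f0 \<gamma>0 p q l =
     rec_error_factor L R P p q f0 \<gamma>0 (growth_factor L R P p q) l"

definition bounds_map ::
  "ereal \<Rightarrow> ereal \<Rightarrow> (real ^ 'e \<Rightarrow> real ^ 'f \<Rightarrow> real ^ 'g) \<Rightarrow> real \<Rightarrow> bool" where
  "bounds_map p q \<beta> c \<longleftrightarrow> (\<forall>u v. lp_norm p (\<beta> u v) \<le> c * lp_norm q u * lp_norm q v)"

text \<open>\<open>\<beta>' \<epsilon>\<close> is the map computed with machine precision \<open>\<epsilon>\<close>. The second order term may depend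
  on the inputs.\<close>

definition bounds_forward_error ::
  "ereal \<Rightarrow> ereal \<Rightarrow> (real \<Rightarrow> real ^ 'e \<Rightarrow> real ^ 'f \<Rightarrow> real ^ 'g) \<Rightarrow>
     (real ^ 'e \<Rightarrow> real ^ 'f \<Rightarrow> real ^ 'g) \<Rightarrow> real \<Rightarrow> bool" where
  "bounds_forward_error p q \<beta>' \<beta> c \<longleftrightarrow>
     (\<forall>u v. \<exists>h \<in> O[at_right 0](\<lambda>\<epsilon>. \<epsilon> ^ 2). \<forall>\<^sub>F \<epsilon> in at_right 0.
        lp_norm p (\<beta>' \<epsilon> u v - \<beta> u v) \<le> c * lp_norm q u * lp_norm q v * \<epsilon> + h \<epsilon>)"

end

theory Submission
  imports Defs
begin

text \<open>The growth factor \<open>\<gamma>\<close> is a norm, hence nonnegative, and positive under the hypotheses of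
  each formula.

  The sum in the recursive error factor is a geometric sum of ratio \<open>\<Gamma> / \<gamma>\<close>. For
  \<open>\<Gamma> < \<gamma>\<close> it equals \<open>(1 - (\<Gamma> / \<gamma>) ^ l) \<cdot> \<gamma> / (\<gamma> - \<Gamma>)\<close>, and the factor \<open>\<gamma> / (\<gamma> - \<Gamma>)\<close>
  is what turns \<open>Q_zero\<close> into \<open>Q_shift \<Gamma>\<close>; multiplying by \<open>\<gamma> ^ l\<close> gives
  \<open>\<gamma> ^ l \<cdot> (f0 + \<Gamma>0 \<cdot> Q_shift \<Gamma>) - \<Gamma>0 \<cdot> Q_shift \<Gamma> \<cdot> \<Gamma> ^ l\<close>
  (\<open>rec_error_factor_geometric\<close>). The four matrix multiplication formulas are instances of this
  one. For a general tensor \<open>\<Gamma> = \<gamma> \<noteq> 0\<close>, so the ratio is 1 and the sum is \<open>l\<close>.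
  The forms in terms of the total dimension hold since that dimension, divided by
  its value at the leaves, is \<open>b ^ l\<close> and \<open>(b ^ l) powr log b \<gamma> = \<gamma> ^ l\<close>.

  The function \<open>t \<mapsto> Q_zero \<cdot> \<gamma> / (\<gamma> - t)\<close> is strictly increasing below \<open>\<gamma>\<close> as soon as \<open>Q_zero\<close> and \<open>\<gamma>\<close> are
  positive. A nonzero growth factor forces \<open>P \<noteq> 0\<close>, and a nonzero row of \<open>P\<close> already
  contributes to \<open>Q_zero\<close> (\<open>Q_zero_pos\<close>).\<close>

lemma lp_norm_nonneg: "0 \<le> lp_norm p (x :: real ^ 'n)"
proof (cases "p = \<infinity>")
  case True
  have "\<bar>x $ undefined\<bar> \<le> Max (range (\<lambda>i. \<bar>x $ i\<bar>))"
    by (rule Max_ge) auto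
  then have "0 \<le> Max (range (\<lambda>i. \<bar>x $ i\<bar>))"
    by (rule order_trans[OF abs_ge_zero])
  with True show ?thesis by (simp add: lp_norm_def)
qed (simp add: lp_norm_def)

lemma lp_norm_zero: "lp_norm p (0 :: real ^ 'n) = 0"
  by (simp add: lp_norm_def)

lemma growth_factor_nonneg: "0 \<le> growth_factor L R P p q"
  by (simp add: growth_factor_def lp_norm_nonneg)

lemma growth_factor_zero: "growth_factor L R 0 p q = 0"
  using lp_norm_zero by (simp add: growth_factor_def zero_vec_def)

lemma Q_zero_pos:
  fixes P :: "real ^ 'r ^ 'g"
  assumes "P \<noteq> 0"
  shows "0 < Q_zero L R P"
proof -
  let ?w = "\<lambda>j. l0_norm (row j P) +
       Max (range (\<lambda>i. (l0_norm (row i L) + l0_norm (row i R)) * of_bool (P $ j $ i \<noteq> 0)))"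
  from assms obtain j i where "P $ j $ i \<noteq> 0"
    by (auto simp: vec_eq_iff)
  then have "i \<in> {i. row j P $ i \<noteq> 0}"
    by (simp add: row_def)
  then have "0 < l0_norm (row j P)"
    unfolding l0_norm_def by (subst card_gt_0_iff) auto
  also have "\<dots> \<le> ?w j" by simp
  also have "\<dots> \<le> Q_zero L R P"
    unfolding Q_zero_def by (rule Max_ge) auto
  finally show ?thesis .
qed

lemma Q_shift_strict_mono:
  assumes "growth_factor L R P p q \<noteq> 0"
  shows "strict_mono_on {..<growth_factor L R P p q} (Q_shift L R P p q)"
proof (rule strict_mono_onI)
  fix s t
  assume "s \<in> {..<growth_factor L R P p q}" "t \<in> {..<growth_factor L R P p q}" "s < t"
  moreover have "0 < growth_factor L R P p q"
    using assms growth_factor_nonneg[of L R P p q] by simp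
  moreover have "0 < Q_zero L R P"
    using assms growth_factor_zero by (metis Q_zero_pos)
  ultimately show "Q_shift L R P p q s < Q_shift L R P p q t"
    unfolding Q_shift_def by (intro mult_strict_left_mono divide_strict_left_mono) auto
qed

text \<open>The common source of the four matrix multiplication formulas. The hypothesis
  \<open>0 \<le> \<Gamma>\<close> serves to make the growth factor positive, so that the ratio is meaningful.\<close>

lemma rec_error_factor_geometric:
  assumes "0 \<le> \<Gamma>" and "\<Gamma> < growth_factor L R P p q"
  shows "rec_error_factor L R P p q f0 \<Gamma>0 \<Gamma> l =
    growth_factor L R P p q ^ l * (f0 + \<Gamma>0 * Q_shift L R P p q \<Gamma>)
      - \<Gamma>0 * Q_shift L R P p q \<Gamma> * \<Gamma> ^ l"
proof -
  define c where "c = growth_factor L R P p q"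
  define S where "S = (\<Sum>i<l. (\<Gamma> / c) ^ i)"
  have c: "0 < c" "\<Gamma> < c" using assms by (auto simp: c_def)
  have "S = (1 - (\<Gamma> / c) ^ l) / (1 - \<Gamma> / c)"
    unfolding S_def using c by (subst sum_gp_strict) auto
  also have "\<dots> = (1 - (\<Gamma> / c) ^ l) * (c / (c - \<Gamma>))"
    using c by (simp add: field_simps)
  finally have sum: "c ^ l * S = (c ^ l - \<Gamma> ^ l) * (c / (c - \<Gamma>))"
    using c by (simp add: power_divide right_diff_distrib)
  have "c ^ l * (f0 + real (Q_zero L R P) * \<Gamma>0 * S) =
      c ^ l * f0 + real (Q_zero L R P) * \<Gamma>0 * (c ^ l * S)"
    by (simp add: distrib_left)
  also note sum
  finally show ?thesis
    unfolding rec_error_factor_def Q_shift_def S_def c_def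
    by (simp add: algebra_simps diff_divide_distrib)
qed

lemma rec_error_factor_tensor_eq:
  assumes "growth_factor L R P p q \<noteq> 0"
  shows "rec_error_factor_tensor L R P f0 \<gamma>0 p q l =
    growth_factor L R P p q ^ l * (f0 + real l * real (Q_zero L R P) * \<gamma>0)"
  using assms by (simp add: rec_error_factor_tensor_def rec_error_factor_def algebra_simps)

text \<open>The growth over \<open>l\<close> recursion levels as a power of the ratio \<open>b ^ l\<close> between the total
  dimension and its value at the leaves.\<close>

lemma power_powr_log:
  fixes b c :: real
  assumes "1 < b" "0 < c"
  shows "(b ^ l) powr log b c = c ^ l"
proof -
  have "(b ^ l) powr log b c = (b powr log b c) powr real l"
    using assms by (simp add: powr_realpow[symmetric] powr_powr mult.commute del: powr_log_cancel)
  also have "\<dots> = c ^ l"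
    using assms by (simp add: powr_realpow)
  finally show ?thesis .
qed

theorem corollary19:
  fixes L :: "real ^ 'e ^ 'r" and R :: "real ^ 'f ^ 'r" and P :: "real ^ 'r ^ 'g"
    and \<beta> :: "real ^ 'e \<Rightarrow> real ^ 'f \<Rightarrow> real ^ 'g"
    and \<beta>0 :: "real ^ 'e0 \<Rightarrow> real ^ 'f0 \<Rightarrow> real ^ 'g0"
    and \<beta>0_hat :: "real \<Rightarrow> real ^ 'e0 \<Rightarrow> real ^ 'f0 \<Rightarrow> real ^ 'g0"
    and \<sigma> :: "'m::finite \<times> 'k::finite \<Rightarrow> 'e" and \<tau> :: "'k \<times> 'n::finite \<Rightarrow> 'f"
    and \<rho> :: "'m \<times> 'n \<Rightarrow> 'g"
    and \<sigma>0 :: "'m0::finite \<times> 'k0::finite \<Rightarrow> 'e0" and \<tau>0 :: "'k0 \<times> 'n0::finite \<Rightarrow> 'f0"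
    and \<rho>0 :: "'m0 \<times> 'n0 \<Rightarrow> 'g0"
    and l k k0 K g g0 G :: nat
    and \<gamma> :: "ereal \<Rightarrow> ereal \<Rightarrow> real" and Q :: "ereal \<Rightarrow> ereal \<Rightarrow> real \<Rightarrow> real"
  assumes "represents L R P \<beta>"
    and "k = CARD('k)" and "k0 = CARD('k0)" and "K = k0 * k ^ l"
    and "g = CARD('g)" and "g0 = CARD('g0)" and "G = g0 * g ^ l"
    and "\<gamma> = growth_factor L R P" and "Q = Q_shift L R P"
  shows
    "(\<forall>p\<ge>1. \<forall>q\<ge>1. \<gamma> p q \<noteq> 0 \<longrightarrow> strict_mono_on {..<\<gamma> p q} (Q p q)) \<and>
     (encodes_matmul \<sigma> \<tau> \<rho> \<beta> \<and> encodes_matmul \<sigma>0 \<tau>0 \<rho>0 \<beta>0 \<and> k \<ge> 2 \<longrightarrow>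
       (let f = rec_error_factor_matmul L R P k0 k; \<Gamma> = (\<lambda>p q. matmul_amplification p q k) in
         (\<Gamma> \<infinity> \<infinity> < \<gamma> \<infinity> \<infinity> \<longrightarrow>
            f \<infinity> \<infinity> l = \<gamma> \<infinity> \<infinity> ^ l * (real k0 ^ 2 + real k0 * Q \<infinity> \<infinity> (real k)) - real k0 * real k ^ l * Q \<infinity> \<infinity> (real k) \<and>
            f \<infinity> \<infinity> l = (real K / real k0) powr log (real k) (\<gamma> \<infinity> \<infinity>) * (real k0 ^ 2 + real k0 * Q \<infinity> \<infinity> (real k)) - real K * Q \<infinity> \<infinity> (real k)) \<and>
         (\<Gamma> 2 2 < \<gamma> 2 2 \<longrightarrow>
            f 2 2 l = \<gamma> 2 2 ^ l * (real k0 + Q 2 2 1) - Q 2 2 1 \<and>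
            f 2 2 l = (real K / real k0) powr log (real k) (\<gamma> 2 2) * (real k0 + Q 2 2 1) - Q 2 2 1) \<and>
         (\<Gamma> 2 \<infinity> < \<gamma> 2 \<infinity> \<longrightarrow>
            f 2 \<infinity> l = \<gamma> 2 \<infinity> ^ l * real k0 powr (3/2) * (real k0 + Q 2 \<infinity> (real k powr (3/2)))
                       - Q 2 \<infinity> (real k powr (3/2)) * (real k0 * real k ^ l) powr (3/2) \<and>
            f 2 \<infinity> l = (real K / real k0) powr log (real k) (\<gamma> 2 \<infinity>) * real k0 powr (3/2) * (real k0 + Q 2 \<infinity> (real k powr (3/2)))
                       - Q 2 \<infinity> (real k powr (3/2)) * real K powr (3/2)) \<and>
         (\<Gamma> \<infinity> 2 < \<gamma> \<infinity> 2 \<longrightarrow>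
            f \<infinity> 2 l = \<gamma> \<infinity> 2 ^ l * (real k0 + Q \<infinity> 2 1) - Q \<infinity> 2 1 \<and>
            f \<infinity> 2 l = (real K / real k0) powr log (real k) (\<gamma> \<infinity> 2) * (real k0 + Q \<infinity> 2 1) - Q \<infinity> 2 1))) \<and>
     (g \<ge> 2 \<longrightarrow>
       (\<forall>p\<ge>1. \<forall>q\<ge>1. \<forall>f0 \<gamma>0.
          \<gamma> p q \<noteq> 0 \<and> bounds_map p q \<beta>0 \<gamma>0 \<and> bounds_forward_error p q \<beta>0_hat \<beta>0 f0 \<longrightarrow>
          (let f = rec_error_factor_tensor L R P f0 \<gamma>0 p q in
             f l = \<gamma> p q ^ l * (f0 + real l * real (Q_zero L R P) * \<gamma>0) \<and>
             f l = (real G / real g0) powr log (real g) (\<gamma> p q) * (f0 + log (real g) (real G / real g0) * real (Q_zero L R P) * \<gamma>0))))"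
proof (intro conjI impI, goal_cases)
  case 1
  show ?case
    using Q_shift_strict_mono assms(8,9) by blast
next
  case 2
  then have k: "2 \<le> k" by simp
  have k0: "0 < k0" using assms(3) by simp
  \<comment> \<open>Each amplification factor is nonnegative, so \<open>\<Gamma> < \<gamma>\<close> gives the positivity of \<open>\<gamma>\<close> that the
    logarithm to base \<open>k\<close> needs.\<close>
  have ratio: "(real k ^ l) powr log (real k) (\<gamma> p q) = \<gamma> p q ^ l"
    if "0 \<le> \<Gamma>" "\<Gamma> < \<gamma> p q" for p q \<Gamma>
    using k that by (intro power_powr_log) auto
  have closed: "rec_error_factor L R P p q f0 \<Gamma>0 \<Gamma> l =
      \<gamma> p q ^ l * (f0 + \<Gamma>0 * Q p q \<Gamma>) - \<Gamma>0 * Q p q \<Gamma> * \<Gamma> ^ l"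
    if "0 \<le> \<Gamma>" "\<Gamma> < \<gamma> p q" for p q f0 \<Gamma>0 \<Gamma>
    using rec_error_factor_geometric[of \<Gamma> L R P p q] that assms(8,9) by simp
  have K: "real K = real k0 * real k ^ l" using assms(4) by simp
  then have K_div: "real K / real k0 = real k ^ l" using k0 by simp
  \<comment> \<open>For the pair \<open>(2, \<infinity>)\<close> the base case amplification \<open>k0 powr (3/2)\<close> divides the base case
    error factor, as in the other three cases, and can be factored out.\<close>
  have half: "real k0 powr (5/2) = real k0 powr (3/2) * real k0"
    using k0 powr_add[of "real k0" "3/2" 1] by simp
  have "(real k ^ l) powr (3/2) = (real k powr (3/2)) ^ l"
    using k by (simp add: powr_power powr_powr powr_realpow[symmetric] mult.commute)
  then have K_powr: "(real k0 * real k ^ l) powr (3/2) = real k0 powr (3/2) * (real k powr (3/2)) ^ l"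
    by (simp add: powr_mult)
  show ?case
    unfolding Let_def K_div rec_error_factor_matmul_def matmul_amplification_def
      classical_error_factor_def
    unfolding K
    by (auto simp: ratio[of 1] ratio[of "real k"] ratio[of "real k powr (3/2)"] closed half K_powr
        algebra_simps power2_eq_square)
next
  case 3
  then have g: "2 \<le> g" .
  have g0: "0 < g0" using assms(6) by simp
  have log_ratio: "log (real g) (real G / real g0) = real l"
    using g g0 assms(7) by (simp add: log_nat_power)
  have ratio: "(real G / real g0) powr log (real g) (\<gamma> p q) = \<gamma> p q ^ l"
    if "\<gamma> p q \<noteq> 0" for p q
    using power_powr_log[of "real g" "\<gamma> p q" l] that g g0
      growth_factor_nonneg[of L R P p q] assms(7,8) by simp
  show ?case
    unfolding Let_def log_ratio using ratio rec_error_factor_tensor_eq assms(8) by metis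
qed

end
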